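(* Let $P$ be a path whose vertex set is partitioned into $m$ nonempty subsets $V_1,\ldots,V_m$. Then there exist two disjoint independent sets $S_1$ and $S_2$ of $P$ such that $S_1\cup S_2$ contains all vertices of $P$ except exactly one vertex in each $V_j$, $\big||S_1|-|S_2|\big|\le 1$, and for each $i\in\{1,2\}$, $$|S_i\cap V_j|\ \ge\ \frac{|V_j|}{2}-1\qquad\text{for all } j\in[m].$$
   Context: An independent set of a graph is a set of vertices no two of which are adjacent. $[m]=\{1,\ldots,m\}$. *)

theory Defs
  imports Complex_Main "HOL-Library.Ramsey" "HOL-Library.Disjoint_Sets"
begin

(* A finite simple graph is given by a vertex set X and a set E of two-element vertex sets. *)

definition path_graph :: "'a set \<Rightarrow> 'a set set \<Rightarrow> bool" where
  "path_graph X E \<longleftrightarrow>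
     (\<exists>xs. xs \<noteq> [] \<and> distinct xs \<and> X = set xs \<and>
           E = {{xs ! i, xs ! Suc i} | i. Suc i < length xs})"

definition independent_set :: "'a set \<Rightarrow> 'a set set \<Rightarrow> 'a set \<Rightarrow> bool" where
  "independent_set X E S \<longleftrightarrow> S \<subseteq> X \<and> indep S E"

end

theory Submission
  imports Defs "HOL-Library.Multiset"
begin

text \<open>
  Number the vertices of the path by \<open>0, \<dots>, n - 1\<close> and describe a pair of disjoint vertex sets by a
  sign vector. Label a nonzero sign vector by a colour class in which one of the signs takes more
  than half of the vertices (or both signs take exactly half), together with that sign; if there is
  no such class, label it by \<open>m\<close> plus the length of its longest alternating subsequence, together
  with the first sign. This labelling is antipodal and has no complementary pair of comparable
  vectors, so by the octahedral Tucker lemma its labels cannot all be below \<open>n\<close> in absolute value.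
  Hence some sign vector has an alternating subsequence of length at least \<open>n - m\<close> while missing at
  least one vertex of each class: it misses exactly one vertex per class, and all its signs alternate.

  The octahedral Tucker lemma follows from Ky Fan's parity count of the alternatingly labelled
  maximal chains of sign vectors, by induction on the dimension.
\<close>

subsection \<open>Alternating label sets\<close>

lemma even_card_involution:
  assumes "finite A" "\<And>a. a \<in> A \<Longrightarrow> \<phi> a \<in> A" "\<And>a. a \<in> A \<Longrightarrow> \<phi> (\<phi> a) = a"
    "\<And>a. a \<in> A \<Longrightarrow> \<phi> a \<noteq> a"
  shows "even (card A)"
  using assms
proof (induction A rule: finite_psubset_induct)
  case (psubset A)
  show ?case
  proof (cases "A = {}")
    case False
    then obtain a where a: "a \<in> A" by blast
    let ?B = "A - {a, \<phi> a}"
    have "even (card ?B)"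
    proof (rule psubset.IH)
      show "?B \<subset> A" using a by blast
      show "\<phi> b \<in> ?B" "\<phi> (\<phi> b) = b" "\<phi> b \<noteq> b" if "b \<in> ?B" for b
        using that a psubset.prems by (auto; metis)+
    qed
    moreover have "card A = card ?B + card {a, \<phi> a}"
      using a psubset.prems(1) psubset.hyps
      by (metis card_Diff_subset card_mono empty_subsetI finite.emptyI finite_insert insert_subset le_add_diff_inverse2)
    moreover have "card {a, \<phi> a} = 2"
      using psubset.prems(3)[OF a] by auto
    ultimately show ?thesis by simp
  qed simp
qed

text \<open>A signed label \<open>\<plusminus>j\<close> is encoded as one of the numbers \<open>2j\<close> and \<open>2j + 1\<close>, so that parity is the sign.\<close>

fun alternating :: "bool \<Rightarrow> nat list \<Rightarrow> bool" where
  "alternating b [] = True"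
| "alternating b (c # cs) \<longleftrightarrow> even c = b \<and> (\<forall>d\<in>set cs. c < d) \<and> alternating (\<not> b) cs"

lemma alternating_strict: "alternating b cs \<Longrightarrow> sorted_wrt (<) cs"
  by (induction cs arbitrary: b) auto

text \<open>The local count of Ky Fan's argument. In an alternating nonempty list exactly one
  deletion leaves a list alternating from \<open>b\<close>: the last entry if the list starts with
  \<open>b\<close>, else the first. In any other sorted list such a deletion must hit a pair of
  neighbours of equal sign, and then both members of the pair qualify. The empty list counts once
  for each initial sign.\<close>

lemma even_alternating_removals:
  assumes "sorted cs"
  shows "even (length (filter (\<lambda>a. alternating b (remove1 a cs)) cs)
    + of_bool (alternating b cs) + of_bool (alternating (\<not> b) cs))"
  using assms
proof (induction cs arbitrary: b)
  case (Cons c cs)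
  show ?case
  proof (cases "c \<in> set cs")
    case False
    then have lt: "\<forall>d\<in>set cs. c < d"
      using Cons.prems by (auto simp: less_le)
    have "filter (\<lambda>a. alternating b (remove1 a (c # cs))) cs
      = filter (\<lambda>a. even c = b \<and> alternating (\<not> b) (remove1 a cs)) cs"
    proof (rule filter_cong[OF refl])
      fix a assume "a \<in> set cs"
      then have "a \<noteq> c" using False by auto
      then show "alternating b (remove1 a (c # cs))
          = (even c = b \<and> alternating (\<not> b) (remove1 a cs))"
        using lt set_remove1_subset[of a cs] by auto
    qed
    then have *: "length (filter (\<lambda>a. alternating b (remove1 a (c # cs))) (c # cs))
      = of_bool (alternating b cs)
        + (if even c = b then length (filter (\<lambda>a. alternating (\<not> b) (remove1 a cs)) cs) else 0)"
      by simp
    show ?thesis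
      unfolding * using Cons.IH[of "\<not> b"] Cons.prems lt
      by (cases "even c = b") auto
  next
    case True
    \<comment> \<open>By sortedness a repeated head also heads the tail. With exactly two copies,
      deleting either leaves \<open>cs\<close>, which counts twice; a third copy rules out every
      deletion.\<close>
    then obtain ds where ds: "cs = c # ds"
      using Cons.prems by (cases cs) (auto simp: order.antisym)
    have no: "\<not> alternating b' (c # cs)" for b' using True by auto
    show ?thesis
    proof (cases "c \<in> set ds")
      case True
      have "\<not> alternating b (remove1 a (c # c # ds))" if "a \<in> set (c # c # ds)" for a
        using True by (cases "a = c") auto
      then have "filter (\<lambda>a. alternating b (remove1 a (c # cs))) (c # cs) = []"
        unfolding ds filter_empty_conv by blast
      then show ?thesis using no[of b] no[of "\<not> b"]
        by (simp del: alternating.simps filter.simps)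
    next
      case False
      have "filter (\<lambda>a. alternating b (remove1 a (c # c # ds))) ds = []"
        unfolding filter_empty_conv using False by auto
      then have "filter (\<lambda>a. alternating b (remove1 a (c # cs))) (c # cs)
          = (if alternating b cs then [c, c] else [])"
        unfolding ds by simp
      then show ?thesis using no[of b] no[of "\<not> b"]
        by (simp del: alternating.simps filter.simps)
    qed
  qed
qed simp

text \<open>Multisets are used because several members of a chain may share a label, and the parity
  count must see each of them.\<close>

definition altm :: "bool \<Rightarrow> nat multiset \<Rightarrow> bool" where
  "altm b M \<longleftrightarrow> alternating b (sorted_list_of_multiset M)"

lemma even_altm_removals:
  "even (size {#a \<in># M. altm b (M - {#a#})#} + of_bool (altm b M) + of_bool (altm (\<not> b) M))"
proof -
  let ?cs = "sorted_list_of_multiset M"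
  have "sorted_list_of_multiset (M - {#a#}) = remove1 a ?cs" for a
  proof -
    have "sorted_list_of_multiset (mset (remove1 a ?cs)) = sort (remove1 a ?cs)"
      by (rule sorted_list_of_multiset_mset)
    also have "\<dots> = remove1 a ?cs"
      by (intro sorted_sort_id sorted_remove1 sorted_sorted_list_of_multiset)
    finally show ?thesis by simp
  qed
  then have "size {#a \<in># M. altm b (M - {#a#})#}
      = size (filter_mset (\<lambda>a. alternating b (remove1 a ?cs)) (mset ?cs))"
    by (simp add: altm_def)
  also have "\<dots> = length (filter (\<lambda>a. alternating b (remove1 a ?cs)) ?cs)"
    by (metis mset_filter size_mset)
  finally have "size {#a \<in># M. altm b (M - {#a#})#}
      = length (filter (\<lambda>a. alternating b (remove1 a ?cs)) ?cs)" .
  then show ?thesis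
    using even_alternating_removals[of ?cs b] unfolding altm_def by simp
qed

text \<open>The same parity with deletions counted by index, so that each deletion is the omission
  of one member of a chain.\<close>

lemma even_altm_index_removals:
  assumes "finite K"
  shows "even (card {k \<in> K. altm b (image_mset h (mset_set (K - {k})))}
    + of_bool (altm b (image_mset h (mset_set K)))
    + of_bool (altm (\<not> b) (image_mset h (mset_set K))))"
proof -
  let ?M = "image_mset h (mset_set K)"
  have rem: "image_mset h (mset_set (K - {k})) = ?M - {#h k#}" if "k \<in> K" for k
    using assms that by (simp add: mset_set_Diff image_mset_Diff)
  have "{#a \<in># ?M. altm b (?M - {#a#})#} = image_mset h (mset_set {k \<in> K. altm b (?M - {#h k#})})"
    using assms by (simp add: filter_mset_image_mset filter_mset_mset_set)
  also have "{k \<in> K. altm b (?M - {#h k#})} = {k \<in> K. altm b (image_mset h (mset_set (K - {k})))}"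
    using rem by auto
  finally have "size {#a \<in># ?M. altm b (?M - {#a#})#}
      = card {k \<in> K. altm b (image_mset h (mset_set (K - {k})))}"
    by simp
  then show ?thesis
    using even_altm_removals[where M = ?M and b = b] by simp
qed

section \<open>Negation of signed labels\<close>

definition flip :: "nat \<Rightarrow> nat" where
  "flip c = (if even c then Suc c else c - 1)"

lemma flip_flip [simp]: "flip (flip c) = c"
  by (auto simp: flip_def)

lemma even_flip [simp]: "even (flip c) \<longleftrightarrow> odd c"
  by (auto simp: flip_def)

text \<open>As \<open>c\<close> and \<open>d\<close> are not complementary, \<open>c < d\<close>
  gives \<open>c div 2 < d div 2\<close>, and \<open>flip\<close> preserves these halves.\<close>

lemma flip_less:
  assumes "c < d" "d \<noteq> flip c"
  shows "flip c < flip d"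
  using assms by (auto simp: flip_def elim!: evenE oddE)

lemma alternating_map_flip:
  assumes "\<And>c d. c \<in> set cs \<Longrightarrow> d \<in> set cs \<Longrightarrow> d \<noteq> flip c"
  shows "alternating b cs \<Longrightarrow> alternating (\<not> b) (map flip cs)"
  using assms
proof (induction cs arbitrary: b)
  case (Cons c cs)
  have "alternating (\<not> \<not> b) (map flip cs)"
    using Cons.prems by (intro Cons.IH) auto
  then show ?case using Cons.prems by (auto intro!: flip_less)
qed simp

lemma altm_image_flip:
  assumes "\<And>c d. c \<in># M \<Longrightarrow> d \<in># M \<Longrightarrow> d \<noteq> flip c" "altm b M"
  shows "altm (\<not> b) (image_mset flip M)"
proof -
  let ?cs = "sorted_list_of_multiset M"
  have alt: "alternating (\<not> b) (map flip ?cs)"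
    using assms unfolding altm_def by (intro alternating_map_flip) auto
  then have "sorted (map flip ?cs)"
    using alternating_strict strict_sorted_imp_sorted by blast
  then have "sort (map flip ?cs) = map flip ?cs"
    by (rule sorted_sort_id)
  then have "sorted_list_of_multiset (image_mset flip M) = map flip ?cs"
    using sorted_list_of_multiset_mset[of "map flip ?cs"] by simp
  then show ?thesis using alt unfolding altm_def by simp
qed

subsection \<open>The octahedral Tucker lemma\<close>

text \<open>A vector over {-1, 0, 1} is stored as the set of its nonzero coordinates with their
  signs: inclusion is the order, \<open>{}\<close> is the zero vector.\<close>

definition sign_vectors :: "nat \<Rightarrow> (nat \<times> bool) set set" where
  "sign_vectors n = {x. x \<subseteq> {..<n} \<times> UNIV \<and> inj_on fst x}"

definition antipode :: "(nat \<times> bool) set \<Rightarrow> (nat \<times> bool) set" where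
  "antipode x = apsnd Not ` x"

text \<open>Signed permutations, giving the order in which the coordinates become nonzero along a
  maximal chain.\<close>

definition facets :: "nat \<Rightarrow> (nat \<times> bool) list set" where
  "facets n = {f. distinct (map fst f) \<and> fst ` set f = {..<n}}"

lemma mem_antipode [simp]: "(i, s) \<in> antipode x \<longleftrightarrow> (i, \<not> s) \<in> x"
  unfolding antipode_def by (force simp: image_iff)

lemma facet_subset: "f \<in> facets n \<Longrightarrow> set f \<subseteq> {..<n} \<times> UNIV"
proof
  fix p assume "f \<in> facets n" "p \<in> set f"
  then have "fst p \<in> {..<n}" unfolding facets_def by blast
  then show "p \<in> {..<n} \<times> UNIV" by (cases p) auto
qed

lemma length_facet: "f \<in> facets n \<Longrightarrow> length f = n"
  using distinct_card[of "map fst f"] by (simp add: facets_def)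

lemma finite_facets: "finite (facets n)"
proof (rule finite_subset)
  show "facets n \<subseteq> {f. set f \<subseteq> {..<n} \<times> UNIV \<and> length f = n}"
    using length_facet facet_subset by blast
qed (simp add: finite_lists_length_eq)

lemma set_take_facet:
  assumes "f \<in> facets n"
  shows "set (take k f) \<in> sign_vectors n"
proof -
  have "inj_on fst (set f)" "set f \<subseteq> {..<n} \<times> UNIV"
    using assms facet_subset by (auto simp: facets_def distinct_map)
  then show ?thesis
    using set_take_subset[of k f] unfolding sign_vectors_def by (auto intro: inj_on_subset)
qed

text \<open>A list \<open>f\<close> stands for the maximal chain of sign vectors \<open>set (take 1 f) \<subset> set (take 2 f) \<subset> \<dots>\<close>,
  and \<open>labels lam f K\<close> collects the labels of its members with index in \<open>K\<close>.\<close>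

definition labels :: "((nat \<times> bool) set \<Rightarrow> nat) \<Rightarrow> (nat \<times> bool) list \<Rightarrow> nat set \<Rightarrow> nat multiset" where
  "labels lam f K = image_mset (\<lambda>k. lam (set (take (Suc k) f))) (mset_set K)"

lemma labels_cong:
  assumes "\<And>k. k \<in> K \<Longrightarrow> set (take (Suc k) f) = set (take (Suc k) g)"
  shows "labels lam f K = labels lam g K"
  unfolding labels_def using assms
  by (cases "finite K") (auto intro!: image_mset_cong)

section \<open>Passing to a neighbouring facet\<close>

definition swap_adj :: "'a list \<Rightarrow> nat \<Rightarrow> 'a list" where
  "swap_adj f k = f[k := f ! Suc k, Suc k := f ! k]"

lemma mset_swap_adj: "Suc k < length f \<Longrightarrow> mset (swap_adj f k) = mset f"
  unfolding swap_adj_def using mset_swap[of "Suc k" f k] by simp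

lemma swap_adj_swap_adj: "Suc k < length f \<Longrightarrow> swap_adj (swap_adj f k) k = f"
  unfolding swap_adj_def by (intro nth_equalityI) (auto simp: nth_list_update)

lemma swap_adj_neq:
  assumes "distinct f" "Suc k < length f"
  shows "swap_adj f k \<noteq> f"
proof
  assume "swap_adj f k = f"
  then have "swap_adj f k ! k = f ! k" by simp
  then show False
    using assms by (simp add: swap_adj_def nth_list_update nth_eq_iff_index_eq)
qed

text \<open>Only the prefix of length \<open>Suc k\<close> separates the two swapped entries, so the
  chains differ at most in the member of index \<open>k\<close>.\<close>

lemma set_take_swap_adj:
  assumes "Suc k < length f" "j \<noteq> k"
  shows "set (take (Suc j) (swap_adj f k)) = set (take (Suc j) f)"
proof (cases "j < k")
  case True
  then show ?thesis by (simp add: swap_adj_def)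
next
  case False
  then have "take (Suc j) (swap_adj f k) = swap_adj (take (Suc j) f) k"
    using assms by (simp add: swap_adj_def take_update_swap)
  then have "mset (take (Suc j) (swap_adj f k)) = mset (take (Suc j) f)"
    using assms False by (simp add: mset_swap_adj)
  then show ?thesis by (rule mset_eq_setD)
qed

lemma swap_adj_facet:
  assumes "f \<in> facets n" "Suc k < n"
  shows "swap_adj f k \<in> facets n"
proof -
  have eq: "mset (swap_adj f k) = mset f"
    using assms length_facet by (intro mset_swap_adj) auto
  then have "mset (map fst (swap_adj f k)) = mset (map fst f)" by simp
  then have "distinct (map fst (swap_adj f k)) = distinct (map fst f)"
    by (rule mset_eq_imp_distinct_iff)
  then show ?thesis
    using assms mset_eq_setD[OF eq] by (simp add: facets_def)
qed

text \<open>For \<open>f\<close> in \<open>facets (Suc m)\<close> the index \<open>m\<close> is the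
  last one, so only the top member of the chain changes.\<close>

definition flip_last :: "nat \<Rightarrow> (nat \<times> bool) list \<Rightarrow> (nat \<times> bool) list" where
  "flip_last m f = f[m := apsnd Not (f ! m)]"

lemma map_fst_flip_last: "map fst (flip_last m f) = map fst f"
proof (cases "m < length f")
  case True
  then have "map fst (flip_last m f) = (map fst f)[m := map fst f ! m]"
    by (simp add: flip_last_def map_update)
  then show ?thesis by simp
qed (simp add: flip_last_def list_update_beyond)

lemma flip_last_facet: "f \<in> facets n \<Longrightarrow> flip_last m f \<in> facets n"
  unfolding facets_def mem_Collect_eq list.set_map[symmetric] map_fst_flip_last .

lemma flip_last_flip_last: "m < length f \<Longrightarrow> flip_last m (flip_last m f) = f"
  by (cases "f ! m") (simp add: flip_last_def list_update_same_conv)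

lemma flip_last_neq: "m < length f \<Longrightarrow> flip_last m f \<noteq> f"
  by (cases "f ! m") (simp add: flip_last_def list_update_same_conv)

section \<open>Ky Fan's parity count\<close>

text \<open>The bound \<open>N\<close> stays fixed while the induction varies the dimension
  \<open>n \<le> N\<close>; vectors on the first \<open>n\<close> coordinates are also vectors on
  \<open>N\<close> coordinates.\<close>

locale fan_labelling =
  fixes lam :: "(nat \<times> bool) set \<Rightarrow> nat" and N :: nat
  assumes antipodal: "x \<in> sign_vectors N \<Longrightarrow> x \<noteq> {} \<Longrightarrow> lam (antipode x) = flip (lam x)"
    and no_complementary:
      "x \<in> sign_vectors N \<Longrightarrow> y \<in> sign_vectors N \<Longrightarrow> x \<noteq> {} \<Longrightarrow> x \<subseteq> y \<Longrightarrow> lam y \<noteq> flip (lam x)"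
begin

definition alt_facets :: "bool \<Rightarrow> nat \<Rightarrow> (nat \<times> bool) list set" where
  "alt_facets b n = {f \<in> facets n. altm b (labels lam f {..<n})}"

text \<open>The hemisphere whose facets carry the last coordinate \<open>m\<close> with positive
  sign.\<close>

definition upper :: "nat \<Rightarrow> (nat \<times> bool) list set" where
  "upper m = {f \<in> facets (Suc m). (m, False) \<notin> set f}"

text \<open>Incidences rather than ridges: a facet together with the index of the omitted member, so
  a ridge occurs once for each upper facet containing it.\<close>

definition ridges :: "nat \<Rightarrow> ((nat \<times> bool) list \<times> nat) set" where
  "ridges m = (SIGMA f:upper m. {k \<in> {..<Suc m}. altm True (labels lam f ({..<Suc m} - {k}))})"

text \<open>Omitting the top member, when coordinate \<open>m\<close> enters last, leaves a chain in
  the equator.\<close>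

definition boundary_ridges :: "nat \<Rightarrow> ((nat \<times> bool) list \<times> nat) set" where
  "boundary_ridges m = {(f, k) \<in> ridges m. k = m \<and> f ! m = (m, True)}"

lemma finite_upper: "finite (upper m)"
  unfolding upper_def by (simp add: finite_facets)

lemma finite_ridges: "finite (ridges m)"
  unfolding ridges_def by (simp add: finite_upper)

text \<open>Every ridge of the upper hemisphere lies in exactly two of its facets,
  except for those on the equator; the involution exchanges the two facets.\<close>

lemma even_inner_ridges: "even (card (ridges m - boundary_ridges m))"
proof (rule even_card_involution)
  \<comment> \<open>Below the top, swapping the entries \<open>k\<close> and \<open>Suc k\<close>
    replaces the member of index \<open>k\<close> alone; at the top, flipping the last sign does. In
    both cases the ridge and its labels are kept.\<close>
  let ?\<phi> = "\<lambda>(f, k). (if k < m then swap_adj f k else flip_last m f, k)"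
  show "finite (ridges m - boundary_ridges m)" by (simp add: finite_ridges)
  fix p assume p: "p \<in> ridges m - boundary_ridges m"
  obtain f k where fk: "p = (f, k)" by (cases p)
  have f: "f \<in> facets (Suc m)" "(m, False) \<notin> set f" "k \<le> m"
    and alt: "altm True (labels lam f ({..<Suc m} - {k}))"
    and nb: "\<not> (k = m \<and> f ! m = (m, True))"
    using p fk unfolding ridges_def boundary_ridges_def upper_def by auto
  have len: "length f = Suc m" using f(1) by (rule length_facet)
  have "?\<phi> p \<in> ridges m - boundary_ridges m \<and> ?\<phi> (?\<phi> p) = p \<and> ?\<phi> p \<noteq> p"
  proof (cases "k < m")
    case True
    let ?g = "swap_adj f k"
    have "labels lam ?g ({..<Suc m} - {k}) = labels lam f ({..<Suc m} - {k})"
      using True len by (intro labels_cong set_take_swap_adj) auto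
    moreover have "set ?g = set f"
      using True len by (intro mset_eq_setD mset_swap_adj) auto
    moreover have "?g \<in> facets (Suc m)" using f(1) True by (simp add: swap_adj_facet)
    moreover have "swap_adj ?g k = f" using True len by (simp add: swap_adj_swap_adj)
    moreover have "?g \<noteq> f"
      using True len f(1) by (intro swap_adj_neq) (auto simp: facets_def simp: distinct_map)
    ultimately show ?thesis
      using fk True f alt unfolding ridges_def boundary_ridges_def upper_def by auto
  next
    case False
    then have k: "k = m" using f(3) by simp
    let ?g = "flip_last m f"
    have "f ! m \<in> set f" using len by simp
    then have fm: "f ! m \<noteq> (m, False)" using f(2) by metis
    \<comment> \<open>Off the boundary the last entry has a coordinate other than \<open>m\<close>,
      so flipping its sign stays in the hemisphere.\<close>
    have ne: "fst (f ! m) \<noteq> m" using fm nb k by (cases "f ! m") auto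
    then have "(m, False) \<notin> set ?g"
      using f(2) set_update_subset_insert[of f m "apsnd Not (f ! m)"]
      unfolding flip_last_def by (cases "f ! m") auto
    moreover have "?g ! m \<noteq> (m, True)"
      using ne len by (cases "f ! m") (auto simp: flip_last_def)
    moreover have "labels lam ?g ({..<Suc m} - {k}) = labels lam f ({..<Suc m} - {k})"
      unfolding k by (rule labels_cong) (auto simp: flip_last_def)
    moreover have "?g \<in> facets (Suc m)" using f(1) by (rule flip_last_facet)
    moreover have "flip_last m ?g = f" "?g \<noteq> f"
      using len by (simp_all add: flip_last_flip_last flip_last_neq)
    ultimately show ?thesis
      using fk k f alt unfolding ridges_def boundary_ridges_def upper_def by auto
  qed
  then show "?\<phi> p \<in> ridges m - boundary_ridges m" "?\<phi> (?\<phi> p) = p" "?\<phi> p \<noteq> p"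
    by blast+
qed

text \<open>Cutting off the final entry \<open>(m, True)\<close> identifies these ridges with facets
  one dimension lower, which feeds the induction.\<close>

lemma card_boundary_ridges: "card (boundary_ridges m) = card (alt_facets True m)"
proof -
  have "bij_betw (\<lambda>g. (g @ [(m, True)], m)) (alt_facets True m) (boundary_ridges m)"
  proof (rule bij_betwI')
    fix g assume g: "g \<in> alt_facets True m"
    then have gf: "g \<in> facets m" and alt: "altm True (labels lam g {..<m})"
      by (auto simp: alt_facets_def)
    have len: "length g = m" using gf by (rule length_facet)
    have notin: "m \<notin> fst ` set g" using gf by (auto simp: facets_def)
    have "{..<Suc m} - {m} = {..<m}" by auto
    moreover have "labels lam (g @ [(m, True)]) {..<m} = labels lam g {..<m}"
      by (rule labels_cong) (auto simp: len)
    moreover have "g @ [(m, True)] \<in> facets (Suc m)"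
      using gf notin by (auto simp: facets_def)
    moreover have "(m, False) \<notin> set (g @ [(m, True)])"
      using notin by (force simp: image_iff)
    ultimately show "(g @ [(m, True)], m) \<in> boundary_ridges m"
      using alt len unfolding boundary_ridges_def ridges_def upper_def by (simp add: nth_append)
  next
    fix p assume "p \<in> boundary_ridges m"
    then obtain f where p: "p = (f, m)" "f ! m = (m, True)" and f: "f \<in> facets (Suc m)"
      and alt: "altm True (labels lam f ({..<Suc m} - {m}))"
      unfolding boundary_ridges_def ridges_def upper_def by auto
    have len: "length f = Suc m" using f by (rule length_facet)
    let ?g = "take m f"
    have eq: "f = ?g @ [(m, True)]"
      using len p(2) by (metis lessI order_refl take_Suc_conv_app_nth take_all)
    have "distinct (map fst (?g @ [(m, True)]))" "fst ` set (?g @ [(m, True)]) = {..<Suc m}"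
      using f eq unfolding facets_def by auto
    then have "?g \<in> facets m"
      unfolding facets_def by (auto simp: lessThan_Suc insert_ident)
    moreover have "labels lam ?g {..<m} = labels lam f ({..<Suc m} - {m})"
    proof -
      have "{..<Suc m} - {m} = {..<m}" by auto
      moreover have "labels lam ?g {..<m} = labels lam f {..<m}"
        by (rule labels_cong) (simp add: min_absorb1)
      ultimately show ?thesis by simp
    qed
    ultimately have "?g \<in> alt_facets True m" using alt by (simp add: alt_facets_def)
    moreover have "p = (?g @ [(m, True)], m)" using p(1) eq by simp
    ultimately show "\<exists>g\<in>alt_facets True m. p = (g @ [(m, True)], m)" by blast
  qed auto
  then show ?thesis using bij_betw_same_card by metis
qed

text \<open>Sum \<open>even_altm_index_removals\<close> over the upper facets: modulo 2, the
  incidences count the upper facets alternating from either sign.\<close>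

lemma even_card_ridges:
  "even (card (ridges m) + card (alt_facets True (Suc m) \<inter> upper m)
    + card (alt_facets False (Suc m) \<inter> upper m))"
proof -
  let ?r = "\<lambda>f. card {k \<in> {..<Suc m}. altm True (labels lam f ({..<Suc m} - {k}))}"
  let ?a = "\<lambda>b f. of_bool (altm b (labels lam f {..<Suc m})) :: nat"
  have card_alt: "card (alt_facets b (Suc m) \<inter> upper m) = (\<Sum>f\<in>upper m. ?a b f)" for b
  proof -
    have "alt_facets b (Suc m) \<inter> upper m = {f \<in> upper m. altm b (labels lam f {..<Suc m})}"
      unfolding alt_facets_def upper_def by auto
    then show ?thesis using finite_upper[of m]
      by (simp add: sum.If_cases of_bool_def Int_def conj_commute)
  qed
  have "card (ridges m) = (\<Sum>f\<in>upper m. ?r f)"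
    unfolding ridges_def by (simp add: finite_upper)
  moreover have "even (\<Sum>f\<in>upper m. ?r f + ?a True f + ?a False f)"
    using even_altm_index_removals[of "{..<Suc m}" True]
    by (intro dvd_sum) (simp add: labels_def)
  ultimately show ?thesis by (simp add: card_alt sum.distrib)
qed

lemma no_complementary_labels:
  assumes "f \<in> facets n" "n \<le> N" "c \<in># labels lam f {..<n}" "d \<in># labels lam f {..<n}"
  shows "d \<noteq> flip c"
proof -
  obtain i j where i: "i < n" "c = lam (set (take (Suc i) f))"
    and j: "j < n" "d = lam (set (take (Suc j) f))"
    using assms by (auto simp: labels_def)
  have sv: "set (take k f) \<in> sign_vectors N" for k
    using set_take_facet[OF assms(1), of k] assms(2) by (fastforce simp: sign_vectors_def)
  have ne: "set (take (Suc k) f) \<noteq> {}" if "k < n" for k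
    using that length_facet[OF assms(1)] by auto
  show ?thesis
  proof (cases "i \<le> j")
    case True
    then show ?thesis
      using no_complementary[OF sv sv ne[OF i(1)] set_take_subset_set_take, of "Suc j"] i j by simp
  next
    case False
    then have "c \<noteq> flip d"
      using no_complementary[OF sv sv ne[OF j(1)] set_take_subset_set_take, of "Suc i"] i j by simp
    then show ?thesis by auto
  qed
qed

text \<open>The antipodal map exchanges the hemispheres and negates all labels. As no two labels of
  a chain are complementary, negation keeps their order, so alternation survives with the other
  initial sign.\<close>

lemma card_lower_alt_facets:
  assumes "Suc m \<le> N"
  shows "card (alt_facets True (Suc m) - upper m) = card (alt_facets False (Suc m) \<inter> upper m)"
proof -
  let ?neg = "map (apsnd Not) :: (nat \<times> bool) list \<Rightarrow> _"
  have neg_neg: "?neg (?neg f) = f" for f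
    by (induction f) auto
  have neg_facet: "?neg f \<in> facets (Suc m)" if "f \<in> facets (Suc m)" for f
    using that by (simp add: facets_def image_image comp_def)
  have neg_alt: "?neg f \<in> alt_facets (\<not> b) (Suc m)" if "f \<in> alt_facets b (Suc m)" for f b
  proof -
    have f: "f \<in> facets (Suc m)" and alt: "altm b (labels lam f {..<Suc m})"
      using that by (auto simp: alt_facets_def)
    have "lam (set (take (Suc k) (?neg f))) = flip (lam (set (take (Suc k) f)))"
      if "k < Suc m" for k
    proof -
      have "set (take (Suc k) f) \<in> sign_vectors N"
        using set_take_facet[OF f, of "Suc k"] assms by (fastforce simp: sign_vectors_def)
      moreover have "set (take (Suc k) f) \<noteq> {}" using length_facet[OF f] by auto
      ultimately show ?thesis
        using antipodal by (simp add: take_map antipode_def)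
    qed
    then have "labels lam (?neg f) {..<Suc m} = image_mset flip (labels lam f {..<Suc m})"
      unfolding labels_def multiset.map_comp by (intro image_mset_cong) simp
    moreover have "altm (\<not> b) (image_mset flip (labels lam f {..<Suc m}))"
      using no_complementary_labels[OF f assms] alt by (intro altm_image_flip) auto
    ultimately show ?thesis
      using neg_facet[OF f] by (simp add: alt_facets_def)
  qed
  have neg_mem: "(m, s) \<in> set (?neg f) \<longleftrightarrow> (m, \<not> s) \<in> set f" for s f
    using mem_antipode[of m s "set f"] by (simp add: antipode_def)
  have cover: "(m, True) \<in> set f \<longleftrightarrow> (m, False) \<notin> set f" if "f \<in> facets (Suc m)" for f
  proof -
    have "m \<in> fst ` set f" and inj: "inj_on fst (set f)"
      using that by (auto simp: facets_def distinct_map)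
    then obtain s where "(m, s) \<in> set f" by auto
    moreover have "s = t" if "(m, s) \<in> set f" "(m, t) \<in> set f" for s t
      using inj_onD[OF inj, of "(m, s)" "(m, t)"] that by simp
    ultimately show ?thesis by (cases s) auto
  qed
  have alt_sub: "alt_facets b (Suc m) \<subseteq> facets (Suc m)" for b
    by (auto simp: alt_facets_def)
  have "bij_betw ?neg (alt_facets True (Suc m) - upper m) (alt_facets False (Suc m) \<inter> upper m)"
  proof (rule bij_betw_byWitness[where f' = ?neg])
    show "?neg ` (alt_facets True (Suc m) - upper m) \<subseteq> alt_facets False (Suc m) \<inter> upper m"
    proof (rule image_subsetI)
      fix f assume "f \<in> alt_facets True (Suc m) - upper m"
      then show "?neg f \<in> alt_facets False (Suc m) \<inter> upper m"
        using neg_alt[of f True] alt_sub cover[of f] neg_facet[of f] neg_mem[of False f]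
        by (auto simp: upper_def)
    qed
    show "?neg ` (alt_facets False (Suc m) \<inter> upper m) \<subseteq> alt_facets True (Suc m) - upper m"
    proof (rule image_subsetI)
      fix f assume "f \<in> alt_facets False (Suc m) \<inter> upper m"
      then show "?neg f \<in> alt_facets True (Suc m) - upper m"
        using neg_alt[of f False] alt_sub cover[of f] neg_facet[of f] neg_mem[of False f]
        by (auto simp: upper_def)
    qed
  qed (intro ballI neg_neg)+
  then show ?thesis by (rule bij_betw_same_card)
qed

text \<open>Ky Fan's lemma for the barycentric subdivision of the cross-polytope.\<close>

theorem odd_card_alt_facets: "n \<le> N \<Longrightarrow> odd (card (alt_facets True n))"
proof (induction n)
  case 0
  have "alt_facets True 0 = {[]}"
    by (auto simp: alt_facets_def facets_def labels_def altm_def)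
  then show ?case by simp
next
  case (Suc m)
  have "card (ridges m) = card (ridges m - boundary_ridges m) + card (boundary_ridges m)"
  proof -
    have "boundary_ridges m \<subseteq> ridges m" by (auto simp: boundary_ridges_def)
    then have "ridges m \<inter> boundary_ridges m = boundary_ridges m" by blast
    then show ?thesis
      using card_Int_Diff[OF finite_ridges[of m], of "boundary_ridges m"] by simp
  qed
  \<comment> \<open>Inner ridges cancel modulo 2, and the boundary ridges are odd in number by the
    induction hypothesis.\<close>
  then have "odd (card (ridges m))"
    using even_inner_ridges[of m] card_boundary_ridges[of m] Suc by simp
  moreover have "card (alt_facets True (Suc m))
      = card (alt_facets True (Suc m) \<inter> upper m) + card (alt_facets True (Suc m) - upper m)"
    by (rule card_Int_Diff) (simp add: alt_facets_def finite_facets)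
  \<comment> \<open>The upper facets alternating from \<open>False\<close> stand for the lower ones
    alternating from \<open>True\<close>, so both hemispheres are counted.\<close>
  ultimately show ?case
    using even_card_ridges[of m] card_lower_alt_facets[OF Suc.prems] by auto
qed

end

text \<open>Without a complementary pair, Fan's count gives a facet with alternating labels. These
  \<open>N\<close> labels are distinct, and so are their absolute values \<open>c div 2\<close>,
  which do not fit below \<open>M < N\<close>.\<close>

theorem octahedral_tucker:
  assumes "\<And>x. x \<in> sign_vectors N \<Longrightarrow> x \<noteq> {} \<Longrightarrow> lam (antipode x) = flip (lam x)"
    and "\<And>x. x \<in> sign_vectors N \<Longrightarrow> x \<noteq> {} \<Longrightarrow> lam x div 2 < M"
    and "M < N"
  shows "\<exists>x\<in>sign_vectors N. \<exists>y\<in>sign_vectors N. x \<noteq> {} \<and> x \<subseteq> y \<and> lam y = flip (lam x)"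
proof (rule ccontr)
  assume no: "\<not> ?thesis"
  interpret fan_labelling lam N
    by unfold_locales (fact assms(1), use no in blast)
  have "alt_facets True N \<noteq> {}"
    using odd_card_alt_facets[of N] by auto
  then obtain f where f: "f \<in> facets N" and "altm True (labels lam f {..<N})"
    unfolding alt_facets_def by auto
  let ?L = "labels lam f {..<N}"
  let ?cs = "sorted_list_of_multiset ?L"
  have "distinct ?cs"
    using \<open>altm True ?L\<close> alternating_strict strict_sorted_iff unfolding altm_def by blast
  moreover have "length ?cs = N"
    by (metis card_lessThan labels_def mset_sorted_list_of_multiset size_image_mset size_mset size_mset_set)
  ultimately have "card (set_mset ?L) = N"
    by (metis distinct_card set_sorted_list_of_multiset)
  moreover have "inj_on (\<lambda>c. c div 2) (set_mset ?L)"
  proof (rule inj_onI, rule ccontr)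
    fix c d assume cd: "c \<in> set_mset ?L" "d \<in> set_mset ?L" "c div 2 = d div 2" "c \<noteq> d"
    from cd(3,4) have "d = flip c" unfolding flip_def by (cases "even c") presburger+
    then show False using no_complementary_labels[OF f order_refl cd(1,2)] by simp
  qed
  moreover have "(\<lambda>c. c div 2) ` set_mset ?L \<subseteq> {..<M}"
  proof clarsimp
    fix c assume "c \<in># ?L"
    then obtain k where "k < N" "c = lam (set (take (Suc k) f))"
      by (auto simp: labels_def)
    moreover have "set (take (Suc k) f) \<noteq> {}" using \<open>k < N\<close> length_facet[OF f] by auto
    ultimately show "c div 2 < M" using assms(2) set_take_facet[OF f] by blast
  qed
  ultimately have "N \<le> M"
    by (metis card_image card_lessThan card_mono finite_lessThan)
  then show False using assms(3) by simp
qed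

subsection \<open>Splitting the path\<close>

definition sign_class :: "(nat \<times> bool) set \<Rightarrow> bool \<Rightarrow> nat set" where
  "sign_class x s = {i. (i, s) \<in> x}"

lemma sign_class_mono: "x \<subseteq> y \<Longrightarrow> sign_class x s \<subseteq> sign_class y s"
  by (auto simp: sign_class_def)

lemma sign_class_antipode [simp]: "sign_class (antipode x) s = sign_class x (\<not> s)"
  by (simp add: sign_class_def)

lemma sign_class_disjoint: "x \<in> sign_vectors n \<Longrightarrow> sign_class x s \<inter> sign_class x (\<not> s) = {}"
  by (auto simp: sign_class_def sign_vectors_def inj_on_def) fastforce+

lemma sign_class_subset: "x \<in> sign_vectors n \<Longrightarrow> sign_class x s \<subseteq> {..<n}"
  by (auto simp: sign_class_def sign_vectors_def)

text \<open>\<open>alt_len x b is\<close> is the length of the longest subsequence of \<open>is\<close> on which the signs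
  given by \<open>x\<close> alternate, starting with \<open>b\<close>; taking signs greedily is optimal.\<close>

fun alt_len :: "(nat \<times> bool) set \<Rightarrow> bool \<Rightarrow> nat list \<Rightarrow> nat" where
  "alt_len x b [] = 0"
| "alt_len x b (i # is) =
    (if i \<in> sign_class x b then Suc (alt_len x (\<not> b) is) else alt_len x b is)"

lemma alt_len_antipode: "alt_len (antipode x) b is = alt_len x (\<not> b) is"
  by (induction "is" arbitrary: b) auto

text \<open>Dropping the first term of an alternating subsequence reverses its initial sign.\<close>

lemma alt_len_le_Suc: "alt_len x b is \<le> Suc (alt_len x (\<not> b) is)"
proof (induction "is" arbitrary: b)
  case (Cons i "is")
  then show ?case using Cons.IH[of b] Cons.IH[of "\<not> b"] by auto
qed simp

lemma alt_len_mono: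
  assumes "x \<subseteq> y"
  shows "alt_len x b is \<le> alt_len y b is"
proof (induction "is" arbitrary: b)
  case (Cons i "is")
  \<comment> \<open>This covers an index that is taken for \<open>y\<close> but not for
    \<open>x\<close>.\<close>
  have "alt_len x b is \<le> Suc (alt_len y (\<not> b) is)"
    using alt_len_le_Suc[of x b "is"] Cons.IH[of "\<not> b"] by simp
  then show ?case
    using Cons.IH[of b] Cons.IH[of "\<not> b"] sign_class_mono[OF assms, of b] by auto
qed simp

text \<open>At the first signed index of the list the sequence starting with its sign gains one term
  over the other. Hence the initial sign of a longest alternating subsequence is well
  defined.\<close>

lemma alt_len_neq:
  assumes "x \<in> sign_vectors n" "i \<in> set is" "i \<in> sign_class x s"
  shows "alt_len x True is \<noteq> alt_len x False is"
  using assms(2)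
proof (induction "is")
  case (Cons k ks)
  then show ?case
    using sign_class_disjoint[OF assms(1), of True] assms(3) by (cases s) auto
qed simp

definition support :: "(nat \<times> bool) set \<Rightarrow> nat set" where
  "support x = sign_class x True \<union> sign_class x False"

lemma sign_class_subset_support: "sign_class x s \<subseteq> support x"
  by (cases s) (auto simp: support_def)

lemma alt_len_le_support: "alt_len x b is \<le> length (filter (\<lambda>i. i \<in> support x) is)"
proof (induction "is" arbitrary: b)
  case (Cons i "is")
  then show ?case
    using Cons.IH[of b] Cons.IH[of "\<not> b"] sign_class_subset_support[of x b]
    by (auto intro: le_SucI)
qed simp

text \<open>Equality in \<open>alt_len_le_support\<close> forces the greedy choice to take every
  signed index, so the equality passes to the tail.\<close>

lemma alt_len_tight_Cons:
  assumes "alt_len x b (i # is) = length (filter (\<lambda>i. i \<in> support x) (i # is))"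
  shows "if i \<in> support x
    then i \<in> sign_class x b \<and> alt_len x (\<not> b) is = length (filter (\<lambda>i. i \<in> support x) is)
    else alt_len x b is = length (filter (\<lambda>i. i \<in> support x) is)"
  using assms alt_len_le_support[of x b "is"] sign_class_subset_support[of x b]
  by (auto split: if_splits)

text \<open>All signs along the support alternate, so neighbours never share a sign; this becomes
  independence in the path.\<close>

lemma alt_len_tight_nonadjacent:
  assumes "x \<in> sign_vectors n" "alt_len x b is = length (filter (\<lambda>i. i \<in> support x) is)"
    "Suc k < length is" "is ! k \<in> sign_class x s"
  shows "is ! Suc k \<notin> sign_class x s"
  using assms(2-)
proof (induction "is" arbitrary: b k)
  case (Cons i "is")
  note tight = alt_len_tight_Cons[OF Cons.prems(1)]
  show ?case
  proof (cases k)
    case 0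
    then have i: "i \<in> sign_class x s" using Cons.prems by simp
    then have tight_is: "alt_len x (\<not> b) is = length (filter (\<lambda>i. i \<in> support x) is)"
      and b: "i \<in> sign_class x b"
      using tight sign_class_subset_support[of x s] by auto
    then have "b = s"
      using i sign_class_disjoint[OF assms(1), of s] by (cases b; cases s) auto
    moreover obtain k ks where ks: "is = k # ks"
      using Cons.prems(2) by (cases "is") auto
    ultimately show ?thesis
      using alt_len_tight_Cons[OF tight_is[unfolded ks]] 0 sign_class_disjoint[OF assms(1), of s]
        sign_class_subset_support[of x s] by (auto split: if_splits)
  next
    case (Suc k')
    then show ?thesis
      using tight Cons.IH[of b k'] Cons.IH[of "\<not> b" k'] Cons.prems by (auto split: if_splits)
  qed
qed simp

text \<open>In an alternating sequence starting with \<open>b\<close> the sign \<open>b\<close>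
  leads by zero or one; this becomes the balance of the two sets.\<close>

lemma alt_len_tight_balanced:
  assumes "x \<in> sign_vectors n" "alt_len x b is = length (filter (\<lambda>i. i \<in> support x) is)"
  shows "length (filter (\<lambda>i. i \<in> sign_class x b) is)
      \<le> Suc (length (filter (\<lambda>i. i \<in> sign_class x (\<not> b)) is))
    \<and> length (filter (\<lambda>i. i \<in> sign_class x (\<not> b)) is)
      \<le> length (filter (\<lambda>i. i \<in> sign_class x b) is)"
  using assms(2)
proof (induction "is" arbitrary: b)
  case (Cons i "is")
  note tight = alt_len_tight_Cons[OF Cons.prems]
  show ?case
  proof (cases "i \<in> support x")
    case True
    then have "i \<in> sign_class x b" "i \<notin> sign_class x (\<not> b)"
      using tight sign_class_disjoint[OF assms(1), of b] by auto
    then show ?thesis using tight True Cons.IH[of "\<not> b"] by auto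
  next
    case False
    then have "i \<notin> sign_class x s" for s using sign_class_subset_support[of x s] by auto
    then show ?thesis using tight False Cons.IH[of b] by auto
  qed
qed simp

section \<open>Heavy signs of a colour class\<close>

text \<open>If the class \<open>I\<close> is covered and split evenly, both strict inequalities fail; the sign of its
  first element then breaks the tie, so that a class with no heavy sign misses an element.\<close>

definition heavy :: "nat set \<Rightarrow> (nat \<times> bool) set \<Rightarrow> bool \<Rightarrow> bool" where
  "heavy I x s \<longleftrightarrow> card I < 2 * card (I \<inter> sign_class x s)
    \<or> card I \<le> 2 * card (I \<inter> sign_class x s)
      \<and> card I \<le> 2 * card (I \<inter> sign_class x (\<not> s)) \<and> Min I \<in> sign_class x s"

lemma heavy_antipode: "heavy I (antipode x) s \<longleftrightarrow> heavy I x (\<not> s)"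
  by (simp add: heavy_def)

text \<open>Both alternatives ask only for lower bounds on sign classes and a membership in one, and
  these persist when \<open>x\<close> grows. For this reason the tie is expressed by two
  inequalities \<open>\<le>\<close> instead of equalities.\<close>

lemma heavy_mono:
  assumes "finite I" "x \<subseteq> y" "heavy I x s"
  shows "heavy I y s"
proof -
  have "card (I \<inter> sign_class x t) \<le> card (I \<inter> sign_class y t)" for t
    using assms(1) sign_class_mono[OF assms(2), of t] by (intro card_mono) auto
  from this[of s] this[of "\<not> s"] show ?thesis
    using assms(3) sign_class_mono[OF assms(2), of s] unfolding heavy_def by fastforce
qed

lemma card_support_Int:
  assumes "x \<in> sign_vectors n" "finite I"
  shows "card (I \<inter> support x) = card (I \<inter> sign_class x s) + card (I \<inter> sign_class x (\<not> s))"
proof -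
  have "I \<inter> support x = (I \<inter> sign_class x s) \<union> (I \<inter> sign_class x (\<not> s))"
    by (cases s) (auto simp: support_def)
  then show ?thesis
    using assms(2) sign_class_disjoint[OF assms(1), of s] by (simp add: card_Un_disjoint Int_ac)
qed

text \<open>The two signs share at most \<open>card I\<close> elements, so a strict majority
  excludes the other sign; in a tie \<open>Min I\<close> has one sign only.\<close>

lemma heavy_unique:
  assumes "x \<in> sign_vectors n" "finite I" "heavy I x s"
  shows "\<not> heavy I x (\<not> s)"
proof -
  have "card (I \<inter> support x) \<le> card I" using assms(2) by (simp add: card_mono)
  then show ?thesis
    using card_support_Int[OF assms(1,2), of s] sign_class_disjoint[OF assms(1), of s] assms(3)
    unfolding heavy_def by auto
qed

lemma card_support_light:
  assumes x: "x \<in> sign_vectors n" and I: "finite I" "I \<noteq> {}" and light: "\<And>s. \<not> heavy I x s"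
  shows "card (I \<inter> support x) < card I"
proof (rule ccontr)
  assume "\<not> ?thesis"
  then have all: "I \<inter> support x = I" using I(1) by (meson card_seteq inf_le1 not_less)
  then have "Min I \<in> support x" using I Min_in by blast
  then obtain s where "Min I \<in> sign_class x s" by (auto simp: support_def)
  then show False
    using light[of s] light[of "\<not> s"] card_support_Int[OF x I(1), of s] all
    unfolding heavy_def by auto
qed

section \<open>The labelling of sign vectors\<close>

lemma flip_double: "flip (2 * k + of_bool b) = 2 * k + of_bool (\<not> b)"
  by (simp add: flip_def)

text \<open>If every vector without heavy classes had only alternating subsequences shorter than
  \<open>n - m\<close>, classes and lengths together would give at most \<open>n - 1\<close>
  absolute values of labels, against \<open>octahedral_tucker\<close>.\<close>

lemma ex_light_alternating_vector:
  fixes I :: "nat \<Rightarrow> nat set"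
  assumes cover: "(\<Union>j\<in>{1..m}. I j) = {..<n}"
    and disj: "disjoint_family_on I {1..m}" and ne: "\<And>j. j \<in> {1..m} \<Longrightarrow> I j \<noteq> {}"
  shows "\<exists>x\<in>sign_vectors n. (\<forall>j\<in>{1..m}. \<forall>s. \<not> heavy (I j) x s) \<and> (\<exists>b. n - m \<le> alt_len x b [0..<n])"
proof -
  have fin: "finite (I j)" if "j \<in> {1..m}" for j
    using cover that by (intro finite_subset[of "I j" "{..<n}"]) auto
  have "m = (\<Sum>j\<in>{1..m}. 1)" by simp
  also have "\<dots> \<le> (\<Sum>j\<in>{1..m}. card (I j))"
    using ne fin by (intro sum_mono) (simp add: Suc_leI card_gt_0_iff)
  also have "\<dots> = card (\<Union>j\<in>{1..m}. I j)"
    using fin disj by (intro card_UN_disjoint[symmetric]) (auto simp: disjoint_family_on_def)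
  finally have "m \<le> n" unfolding cover card_lessThan .
  show ?thesis
  proof (cases "m = n")
    case True
    \<comment> \<open>Here \<open>n - m\<close> is 0 and the zero vector serves, since the classes
      are nonempty.\<close>
    have "\<not> heavy (I j) {} s" if "j \<in> {1..m}" for j s
      using ne[OF that] fin[OF that] by (simp add: heavy_def sign_class_def)
    moreover have "{} \<in> sign_vectors n" by (simp add: sign_vectors_def)
    ultimately show ?thesis using True by (intro bexI[of _ "{}"]) simp_all
  next
    case False
    show ?thesis
    proof (rule ccontr)
      assume contr: "\<not> ?thesis"
      define H where "H x = {j \<in> {1..m}. \<exists>s. heavy (I j) x s}" for x
      define jj where "jj x = Min (H x)" for x
      define a where "a x = max (alt_len x True [0..<n]) (alt_len x False [0..<n])" for x
      \<comment> \<open>The absolute value of the label, counted from 0: classes occupy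
        \<open>0\<close> to \<open>m - 1\<close>. Lengths satisfy \<open>1 \<le> a x < n - m\<close>
        for nonzero \<open>x\<close> without heavy class, so they occupy \<open>m\<close> to
        \<open>n - 2\<close>.\<close>
      define key where "key x = (if H x \<noteq> {} then jj x - 1 else m + a x - 1)" for x
      define pos where "pos x \<longleftrightarrow> (if H x \<noteq> {} then heavy (I (jj x)) x True
        else alt_len x False [0..<n] < alt_len x True [0..<n])" for x
      define lam where "lam x = 2 * key x + of_bool (\<not> pos x)" for x
      have jj: "jj x \<in> H x" if "H x \<noteq> {}" for x
        using that Min_in[of "H x"] by (simp add: jj_def H_def)
      have jjm: "1 \<le> jj x" "jj x \<le> m" if "H x \<noteq> {}" for x
        using jj[OF that] by (auto simp: H_def)
      have neq: "alt_len x True [0..<n] \<noteq> alt_len x False [0..<n]"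
        if x: "x \<in> sign_vectors n" "x \<noteq> {}" for x
      proof -
        obtain i s where "(i, s) \<in> x" using x(2) by auto
        then show ?thesis
          using x(1) by (intro alt_len_neq[OF x(1), of i _ s])
            (auto simp: sign_class_def sign_vectors_def)
      qed
      have a_pos: "1 \<le> a x" if "x \<in> sign_vectors n" "x \<noteq> {}" for x
        using neq[OF that] by (simp add: a_def)
      have a_less: "a x < n - m" if "x \<in> sign_vectors n" "H x = {}" for x
      proof -
        have "\<forall>j\<in>{1..m}. \<forall>s. \<not> heavy (I j) x s" using that(2) by (auto simp: H_def)
        then have "\<not> n - m \<le> alt_len x b [0..<n]" for b using contr that(1) by blast
        then show ?thesis by (simp add: a_def not_le)
      qed
      have "\<exists>x\<in>sign_vectors n. \<exists>y\<in>sign_vectors n. x \<noteq> {} \<and> x \<subseteq> y \<and> lam y = flip (lam x)"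
      proof (rule octahedral_tucker)
        show "n - 1 < n" using \<open>m \<le> n\<close> False by simp
        fix x assume x: "x \<in> sign_vectors n" "x \<noteq> {}"
        have "H (antipode x) = H x"
          by (simp add: H_def heavy_antipode ex_bool_eq disj_commute)
        moreover have "a (antipode x) = a x"
          by (simp add: a_def alt_len_antipode max.commute)
        ultimately have "key (antipode x) = key x" and jja: "jj (antipode x) = jj x"
          by (simp_all add: key_def jj_def)
        moreover have "pos (antipode x) \<longleftrightarrow> \<not> pos x"
        proof (cases "H x = {}")
          case True
          then show ?thesis
            using \<open>H (antipode x) = H x\<close> neq[OF x] by (auto simp: pos_def alt_len_antipode)
        next
          case False
          then obtain s where s: "jj x \<in> {1..m}" "heavy (I (jj x)) x s"
            using jj by (auto simp: H_def)
          then have "heavy (I (jj x)) x True \<longleftrightarrow> \<not> heavy (I (jj x)) x False"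
            using heavy_unique[OF x(1) fin[OF s(1)] s(2)] by (cases s) auto
          then show ?thesis
            using \<open>H (antipode x) = H x\<close> False jja by (auto simp: pos_def heavy_antipode)
        qed
        ultimately show "lam (antipode x) = flip (lam x)"
          by (simp only: lam_def flip_double)
        have "key x < n - 1"
        proof (cases "H x = {}")
          case True
          then show ?thesis using a_less[OF x(1) True] a_pos[OF x] by (simp add: key_def)
        next
          case H: False
          then show ?thesis using jjm[OF H] \<open>m \<le> n\<close> False by (simp add: key_def)
        qed
        then show "lam x div 2 < n - 1" by (simp add: lam_def)
      qed
      then obtain x y where xy: "x \<in> sign_vectors n" "y \<in> sign_vectors n" "x \<noteq> {}" "x \<subseteq> y"
        and "lam y = flip (lam x)" by blast
      then have "2 * key y + of_bool (\<not> pos y) = 2 * key x + of_bool (pos x)"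
        by (simp only: lam_def flip_double not_not)
      then have key: "key y = key x" and pos: "pos y \<longleftrightarrow> \<not> pos x"
        by (cases "pos x"; cases "pos y"; simp; presburger)+
      have "y \<noteq> {}" using xy by auto
      have "H x \<subseteq> H y"
        using heavy_mono[OF fin xy(4)] unfolding H_def by blast
      show False
      proof (cases "H y = {}")
        case True
        then have "H x = {}" using \<open>H x \<subseteq> H y\<close> by auto
        then have "a x = a y"
          using key True a_pos[OF xy(1,3)] a_pos[OF xy(2) \<open>y \<noteq> {}\<close>] by (simp add: key_def)
        \<comment> \<open>If the longest subsequence of \<open>x\<close> starts with
          \<open>b\<close> and that of \<open>y\<close>, equally long, with the other sign,
          monotonicity gives \<open>y\<close> one of this length starting with \<open>b\<close> as
          well, against \<open>alt_len_neq\<close>.\<close>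
        then show False
          using pos \<open>H x = {}\<close> True neq[OF xy(1,3)] neq[OF xy(2) \<open>y \<noteq> {}\<close>]
            alt_len_mono[OF xy(4), of True "[0..<n]"] alt_len_mono[OF xy(4), of False "[0..<n]"]
            alt_len_le_Suc[of y True "[0..<n]"] alt_len_le_Suc[of y False "[0..<n]"]
          by (auto simp: pos_def a_def max_def split: if_splits)
      next
        case Hy: False
        \<comment> \<open>A class label lies below \<open>m\<close>, a length label does
          not.\<close>
        have Hx: "H x \<noteq> {}"
        proof
          assume "H x = {}"
          then show False using key Hy jjm[OF Hy] a_pos[OF xy(1,3)] by (simp add: key_def)
        qed
        then have eq: "jj y = jj x"
          using key Hy jjm[OF Hx] jjm[OF Hy] by (simp add: key_def)
        have "jj x \<in> {1..m}" using jjm[OF Hx] by simp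
        then have "finite (I (jj x))" by (rule fin)
        obtain s where s: "heavy (I (jj x)) x s" using jj[OF Hx] by (auto simp: H_def)
        then have s': "heavy (I (jj x)) y s"
          using heavy_mono[OF \<open>finite (I (jj x))\<close> xy(4)] by blast
        \<comment> \<open>The heavy sign of the common class persists from \<open>x\<close> to
          \<open>y\<close> and is unique in each, so the labels agree in sign.\<close>
        have "pos x \<longleftrightarrow> s" "pos y \<longleftrightarrow> s"
          using heavy_unique[OF xy(1) \<open>finite (I (jj x))\<close> s] heavy_unique[OF xy(2) \<open>finite (I (jj x))\<close> s']
            s s' Hx Hy eq by (cases s; simp add: pos_def)+
        then show False using pos by simp
      qed
    qed
  qed
qed

text \<open>Each light class misses an element, so the support has at most \<open>n - m\<close>
  elements, while the alternating subsequence inside it has at least \<open>n - m\<close>. Equality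
  holds throughout: one miss per class, and all signs alternate.\<close>

lemma ex_fair_alternating_vector:
  fixes I :: "nat \<Rightarrow> nat set"
  assumes cover: "(\<Union>j\<in>{1..m}. I j) = {..<n}"
    and disj: "disjoint_family_on I {1..m}" and ne: "\<And>j. j \<in> {1..m} \<Longrightarrow> I j \<noteq> {}"
  shows "\<exists>x\<in>sign_vectors n.
    (\<forall>k s. Suc k < n \<longrightarrow> k \<in> sign_class x s \<longrightarrow> Suc k \<notin> sign_class x s) \<and>
    \<bar>int (card (sign_class x True)) - int (card (sign_class x False))\<bar> \<le> 1 \<and>
    (\<forall>j\<in>{1..m}. card (I j - support x) = 1) \<and>
    (\<forall>j\<in>{1..m}. \<forall>s. card (I j) \<le> 2 * card (I j \<inter> sign_class x s) + 2)"
proof -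
  obtain x b where x: "x \<in> sign_vectors n" and light: "\<And>j s. j \<in> {1..m} \<Longrightarrow> \<not> heavy (I j) x s"
    and alt: "n - m \<le> alt_len x b [0..<n]"
    using ex_light_alternating_vector[OF assms] by blast
  have fin: "finite (I j)" if "j \<in> {1..m}" for j
    using cover that by (intro finite_subset[of "I j" "{..<n}"]) auto
  have card_UN: "card (\<Union>j\<in>{1..m}. I j \<inter> A) = (\<Sum>j\<in>{1..m}. card (I j \<inter> A))" for A
    using fin disj by (intro card_UN_disjoint) (auto simp: disjoint_family_on_def)
  have supp: "support x \<subseteq> {..<n}" using sign_class_subset[OF x] by (auto simp: support_def)
  have len: "length (filter (\<lambda>i. i \<in> A) [0..<n]) = card A" if "A \<subseteq> {..<n}" for A
  proof -
    have "length (filter (\<lambda>i. i \<in> A) [0..<n]) = card (set (filter (\<lambda>i. i \<in> A) [0..<n]))"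
      by (simp only: distinct_card distinct_filter distinct_upt)
    also have "set (filter (\<lambda>i. i \<in> A) [0..<n]) = A" using that by auto
    finally show ?thesis .
  qed
  have le: "Suc (card (I j \<inter> support x)) \<le> card (I j)" if "j \<in> {1..m}" for j
    using card_support_light[OF x fin[OF that] ne[OF that]] light[OF that] by (simp add: Suc_leI)
  have sum_I: "(\<Sum>j\<in>{1..m}. card (I j)) = n"
    using card_UN[of UNIV] cover by simp
  have "(\<Union>j\<in>{1..m}. I j \<inter> support x) = support x" using cover supp by blast
  then have sum_supp: "(\<Sum>j\<in>{1..m}. Suc (card (I j \<inter> support x))) = card (support x) + m"
    using card_UN[of "support x"] by (simp add: sum.distrib sum_Suc)
  have up: "alt_len x b [0..<n] \<le> card (support x)"
    using alt_len_le_support[of x b "[0..<n]"] len[OF supp] by simp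
  have "(\<Sum>j\<in>{1..m}. Suc (card (I j \<inter> support x))) \<le> (\<Sum>j\<in>{1..m}. card (I j))"
    using le by (rule sum_mono)
  then have total: "card (support x) + m = n" and "alt_len x b [0..<n] = card (support x)"
    using alt up sum_I sum_supp by linarith+
  then have tight: "alt_len x b [0..<n] = length (filter (\<lambda>i. i \<in> support x) [0..<n])"
    using len[OF supp] by simp
  \<comment> \<open>Termwise inequalities whose sums agree are equalities.\<close>
  have miss: "Suc (card (I j \<inter> support x)) = card (I j)" if "j \<in> {1..m}" for j
    using sum_mono_inv[of "\<lambda>j. Suc (card (I j \<inter> support x))" "{1..m}" "\<lambda>j. card (I j)" j]
      le total sum_I sum_supp that by simp
  show ?thesis
  proof (intro bexI[OF _ x] conjI allI impI ballI)
    fix k s assume "Suc k < n" "k \<in> sign_class x s"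
    then show "Suc k \<notin> sign_class x s"
      using alt_len_tight_nonadjacent[OF x tight, of k s] by simp
  next
    show "\<bar>int (card (sign_class x True)) - int (card (sign_class x False))\<bar> \<le> 1"
      using alt_len_tight_balanced[OF x tight] len[OF sign_class_subset[OF x]]
      by (cases b) auto
  next
    fix j assume j: "j \<in> {1..m}"
    have "card (I j) = card (I j \<inter> support x) + card (I j - support x)"
      by (rule card_Int_Diff[OF fin[OF j]])
    then show "card (I j - support x) = 1" using miss[OF j] by simp
  next
    fix j s assume j: "j \<in> {1..m}"
    \<comment> \<open>The other sign takes at most half of the class and one element is missed,
      which leaves at least half minus one for \<open>s\<close>.\<close>
    have "2 * card (I j \<inter> sign_class x (\<not> s)) \<le> card (I j)"
      using light[OF j, of "\<not> s"] by (simp add: heavy_def)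
    then show "card (I j) \<le> 2 * card (I j \<inter> sign_class x s) + 2"
      using miss[OF j] card_support_Int[OF x fin[OF j], of s] by simp
  qed
qed

section \<open>Transfer from indices to the vertices of the path\<close>

theorem theorem1:
  fixes X :: "'a set" and E :: "'a set set" and m :: nat and V :: "nat \<Rightarrow> 'a set"
  assumes "path_graph X E"
    and "(\<Union>j\<in>{1..m}. V j) = X"
    and "disjoint_family_on V {1..m}"
    and "\<forall>j\<in>{1..m}. V j \<noteq> {}"
  shows "\<exists>S1 S2.
           independent_set X E S1 \<and> independent_set X E S2 \<and> S1 \<inter> S2 = {} \<and>
           (\<forall>j\<in>{1..m}. card (V j - (S1 \<union> S2)) = 1) \<and>
           \<bar>int (card S1) - int (card S2)\<bar> \<le> 1 \<and>
           (\<forall>S\<in>{S1, S2}. \<forall>j\<in>{1..m}. real (card (S \<inter> V j)) \<ge> real (card (V j)) / 2 - 1)"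
proof -
  obtain xs where xs: "distinct xs" "X = set xs"
    and E: "E = {{xs ! i, xs ! Suc i} | i. Suc i < length xs}"
    using assms(1) unfolding path_graph_def by blast
  let ?n = "length xs"
  let ?v = "\<lambda>i. xs ! i"
  define I where "I j = {i \<in> {..<?n}. ?v i \<in> V j}" for j
  have inj: "inj_on ?v {..<?n}" using xs(1) by (simp add: inj_on_nth)
  have image_n: "?v ` {..<?n} = X" using xs(2) by (auto simp: set_conv_nth)
  have VI: "?v ` I j = V j" if "j \<in> {1..m}" for j
  proof -
    have "V j \<subseteq> ?v ` {..<?n}" using that assms(2) image_n by blast
    then show ?thesis unfolding I_def by blast
  qed
  have "(\<Union>j\<in>{1..m}. I j) = {..<?n}"
    using assms(2) image_n unfolding I_def by blast
  moreover have "disjoint_family_on I {1..m}"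
    using assms(3) unfolding I_def disjoint_family_on_def by blast
  moreover have "I j \<noteq> {}" if "j \<in> {1..m}" for j
    using VI[OF that] assms(4) that by blast
  ultimately obtain x where x: "x \<in> sign_vectors ?n"
    and nonadj: "\<And>k s. Suc k < ?n \<Longrightarrow> k \<in> sign_class x s \<Longrightarrow> Suc k \<notin> sign_class x s"
    and bal: "\<bar>int (card (sign_class x True)) - int (card (sign_class x False))\<bar> \<le> 1"
    and miss: "\<And>j. j \<in> {1..m} \<Longrightarrow> card (I j - support x) = 1"
    and fair: "\<And>j s. j \<in> {1..m} \<Longrightarrow> card (I j) \<le> 2 * card (I j \<inter> sign_class x s) + 2"
    using ex_fair_alternating_vector[of I m ?n] by blast
  define S where "S s = ?v ` sign_class x s" for s
  have sub: "sign_class x s \<subseteq> {..<?n}" for s using sign_class_subset[OF x] .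
  have I_sub: "I j \<subseteq> {..<?n}" for j by (auto simp: I_def)
  have card_v: "card (?v ` A) = card A" if "A \<subseteq> {..<?n}" for A
    using that inj by (intro card_image inj_on_subset[OF inj])
  have Int_v: "?v ` A \<inter> ?v ` B = ?v ` (A \<inter> B)" if "A \<subseteq> {..<?n}" "B \<subseteq> {..<?n}" for A B
    using inj_on_image_Int[OF inj that] by simp
  have indep: "independent_set X E (S s)" for s
  proof -
    have "{?v i, ?v k} \<notin> E" if ik: "i \<in> sign_class x s" "k \<in> sign_class x s" for i k
    proof
      assume "{?v i, ?v k} \<in> E"
      then obtain l where l: "Suc l < ?n" "{?v i, ?v k} = {?v l, ?v (Suc l)}"
        unfolding E by blast
      have "?v ` {i, k} = ?v ` {l, Suc l}" using l(2) by simp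
      moreover have "{i, k} \<subseteq> {..<?n}" "{l, Suc l} \<subseteq> {..<?n}" using ik sub l(1) by auto
      \<comment> \<open>An edge is given by its vertices; injectivity of the numbering recovers the
        two consecutive indices.\<close>
      ultimately have "{i, k} = {l, Suc l}" by (simp only: inj_on_image_eq_iff[OF inj])
      then have "l \<in> sign_class x s" "Suc l \<in> sign_class x s" using ik by (auto simp: doubleton_eq_iff)
      then show False using nonadj[OF l(1)] by blast
    qed
    moreover have "S s \<subseteq> X" using sub image_n unfolding S_def by blast
    ultimately show ?thesis
      unfolding independent_set_def indep_def S_def by blast
  qed
  have "S True \<inter> S False = {}"
    using Int_v[OF sub sub, of True False] sign_class_disjoint[OF x, of True] by (simp add: S_def)
  moreover have "card (V j - (S True \<union> S False)) = 1" if j: "j \<in> {1..m}" for j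
  proof -
    have "support x \<subseteq> {..<?n}" using sub by (auto simp: support_def)
    then have "?v ` (I j - support x) = ?v ` I j - ?v ` support x"
      using inj_on_image_set_diff[OF inj, of "I j" "support x"] I_sub[of j] by blast
    also have "\<dots> = V j - (S True \<union> S False)"
      by (simp add: VI[OF j] S_def support_def image_Un)
    finally show ?thesis using card_v[of "I j - support x"] I_sub[of j] miss[OF j] by auto
  qed
  moreover have "\<bar>int (card (S True)) - int (card (S False))\<bar> \<le> 1"
    using bal card_v[OF sub] by (simp add: S_def)
  moreover have "real (card (S s \<inter> V j)) \<ge> real (card (V j)) / 2 - 1" if j: "j \<in> {1..m}" for s j
  proof -
    have "S s \<inter> V j = ?v ` (I j \<inter> sign_class x s)"
      using Int_v[OF sub I_sub, of s j] VI[OF j] by (simp add: S_def Int_commute)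
    then have "card (S s \<inter> V j) = card (I j \<inter> sign_class x s)"
      using card_v[of "I j \<inter> sign_class x s"] I_sub[of j] by auto
    moreover have "card (V j) = card (I j)" using card_v[OF I_sub[of j]] VI[OF j] by simp
    ultimately show ?thesis using fair[OF j, of s] by (simp add: field_simps)
  qed
  ultimately show ?thesis
    using indep by (intro exI[of _ "S True"] exI[of _ "S False"]) auto
qed

end
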